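(* Let $E\in C^1(H,\mathbb{R})$, let $v\in S_H\backslash L$, $d\in[L,v]^\bot$, and let $p$ be a peak selection of $E$ with respect to $L$. Write $p(u)=t_u u+w_u^L$ for $u\in S_H$, with $t_u\ge 0$ and $w_u^L\in L$. For $\alpha\in\mathbb{R}$ put $v(\alpha)=\frac{v+\alpha d}{\|v+\alpha d\|}$, and assume $t_{v(\alpha)}>0$ for all $\alpha\geq 0$. Assume that (i) $p$ is locally Lipschitz continuous on the curve $\{v(\alpha):\alpha\ge 0\}$; (ii) $t_v>0$; (iii) $d$ is a descent direction of $E$ with respect to $L$ at $p(v)$, i.e. $\langle E'(p(v)),d\rangle<0$; (iv) $\inf_{\alpha>0}E(p(v(\alpha)))>-\infty$. Then, for any given $\sigma_1,\sigma_2$ with $0<\sigma_1<\sigma_2<1$, there exist two positive constants $\bar\alpha_1<\bar\alpha_2$ such that every $\alpha\in(\bar\alpha_1,\bar\alpha_2)$ satisfies the normalized strong Wolfe-Powell-type step-size search rule $$E(p(v(\alpha)))\le E(p(v))+\sigma_1\alpha\, t_v\langle E'(p(v)),d\rangle,\qquad \hat t_{v(\alpha)}\big|\langle E'(p(v(\alpha))),d\rangle\big|\le-\sigma_2 t_v\langle E'(p(v)),d\rangle,$$ and therefore also the normalized Wolfe-Powell-type step-size search rule $$E(p(v(\alpha)))\le E(p(v))+\sigma_1\alpha\, t_v\langle E'(p(v)),d\rangle,\qquad \hat t_{v(\alpha)}\langle E'(p(v(\alpha))),d\rangle\ge\sigma_2 t_v\langle E'(p(v)),d\rangle,$$ where $\hat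 t_{v(\alpha)}=t_{v(\alpha)}/\sqrt{1+\alpha^2\|d\|^2}$.
   Context: $H$ is a real Hilbert space with inner product $(\cdot,\cdot)$ and norm $\|\cdot\|$; $\langle\cdot,\cdot\rangle$ is the duality pairing between $H^*$ and $H$; $E'$ is the Fréchet derivative of $E$. $S_H=\{v\in H:\|v\|=1\}$. $L\subset H$ is a given finite-dimensional (closed) subspace. For $v\in S_H$, $[L,v]=\{tv+w: t\ge0,\ w\in L\}$, and $[L,v]^\bot$ is the set of all $u\in H$ orthogonal to every element of $[L,v]$ (equivalently, to $v$ and to $L$). The peak mapping of $E$ with respect to $L$ assigns to $v\in S_H$ the set $P(v)$ of all local maximum points of $E$ on $[L,v]$. A peak selection of $E$ with respect to $L$ is a single-valued map $p:S_H\to H$ with $p(v)\in P(v)$ for all $v\in S_H$. Standing assumption: $0\in H$ is a local minimizer of $E$. *)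

theory Defs
  imports "HOL-Analysis.Analysis"
begin

definition local_minimizer :: "('a::metric_space \<Rightarrow> real) \<Rightarrow> 'a \<Rightarrow> bool" where
  "local_minimizer f x \<longleftrightarrow> (\<exists>\<epsilon>>0. \<forall>y\<in>ball x \<epsilon>. f x \<le> f y)"

(* Maximality is relative to S: only competitors inside S are considered. *)
definition local_max_point_on :: "('a::metric_space \<Rightarrow> real) \<Rightarrow> 'a set \<Rightarrow> 'a \<Rightarrow> bool" where
  "local_max_point_on f S x \<longleftrightarrow> x \<in> S \<and> (\<exists>\<epsilon>>0. \<forall>y\<in>S \<inter> ball x \<epsilon>. f y \<le> f x)"

(* The half space [L,v]. *)
definition half_space :: "'a::real_vector set \<Rightarrow> 'a \<Rightarrow> 'a set" where
  "half_space L v = {t *\<^sub>R v + w | t w. 0 \<le> t \<and> w \<in> L}"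

definition peak_mapping :: "('a::real_normed_vector \<Rightarrow> real) \<Rightarrow> 'a set \<Rightarrow> 'a \<Rightarrow> 'a set" where
  "peak_mapping E L v = {u. local_max_point_on E (half_space L v) u}"

(* p is a total function; its values off the unit sphere are irrelevant. *)
definition peak_selection ::
    "('a::real_normed_vector \<Rightarrow> real) \<Rightarrow> 'a set \<Rightarrow> ('a \<Rightarrow> 'a) \<Rightarrow> bool" where
  "peak_selection E L p \<longleftrightarrow> (\<forall>v\<in>sphere 0 1. p v \<in> peak_mapping E L v)"

(* The restriction of f to S is locally Lipschitz. The library's local_lipschitz is a uniform
   version for families of functions indexed by a metric parameter space. *)
definition locally_lipschitz_on ::
    "'a::metric_space set \<Rightarrow> ('a \<Rightarrow> 'b::metric_space) \<Rightarrow> bool" where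
  "locally_lipschitz_on S f \<longleftrightarrow>
     (\<forall>x\<in>S. \<exists>\<epsilon>>0. \<exists>C. C-lipschitz_on (S \<inter> ball x \<epsilon>) f)"

(* The point v(alpha) of the normalized search curve. *)
definition search_curve :: "'a::real_normed_vector \<Rightarrow> 'a \<Rightarrow> real \<Rightarrow> 'a" where
  "search_curve v d \<alpha> = (v + \<alpha> *\<^sub>R d) /\<^sub>R norm (v + \<alpha> *\<^sub>R d)"

(* The factor written t-hat at v(alpha); t assigns to u the coefficient t_u of u in p(u). *)
definition normalized_coeff ::
    "('a::real_normed_vector \<Rightarrow> real) \<Rightarrow> 'a \<Rightarrow> 'a \<Rightarrow> real \<Rightarrow> real" where
  "normalized_coeff t v d \<alpha> = t (search_curve v d \<alpha>) / sqrt (1 + \<alpha>\<^sup>2 * (norm d)\<^sup>2)"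

end

theory Submission
  imports Defs
begin

text \<open>
  Along the search curve put \<open>\<phi> \<alpha> = E (p (v(\<alpha>)))\<close> and let \<open>c \<alpha>\<close> be the normalized coefficient, so
  that \<open>p (v(\<alpha>)) = c \<alpha> (v + \<alpha> d) + w\<close> with \<open>w \<in> L\<close>. The heart of the matter is that \<open>\<phi>\<close> is
  continuously differentiable on \<open>[0, \<infinity>)\<close> with \<open>\<phi>' \<alpha> = c \<alpha> \<langle>E'(p (v(\<alpha>))), d\<rangle>\<close>, although \<open>p\<close> is
  merely Lipschitz. Since \<open>p (v(\<alpha>))\<close> is a local maximum at which the ray coefficient is positive,
  \<open>E'(p (v(\<alpha>)))\<close> kills \<open>L\<close> and \<open>v + \<alpha> d\<close> (lemma \<open>derivative_zero_at_half_space_max\<close>), hence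
  applied to the increment \<open>p (v(\<beta>)) - p (v(\<alpha>))\<close> it leaves only
  \<open>(\<beta> - \<alpha>) c \<beta> \<langle>E'(p (v(\<alpha>))), d\<rangle>\<close>. As the increment is \<open>O(\<beta> - \<alpha>)\<close>, the Frechet remainder of \<open>E\<close> is
  \<open>o(\<beta> - \<alpha>)\<close> and only the continuity of \<open>c\<close> is left to check
  (lemma \<open>has_real_derivative_along_lipschitz_curve\<close>). That continuity follows by taking the inner
  product of \<open>p (v(\<alpha>))\<close> with the component \<open>q\<close> of \<open>v\<close> orthogonal to \<open>L\<close>: the vector \<open>q\<close> is
  orthogonal to \<open>L\<close> and to \<open>d\<close>, so the inner product equals \<open>c \<alpha> \<parallel>q\<parallel>\<^sup>2\<close>.

  The rest is the one-dimensional Wolfe-Powell argument (lemma \<open>strong_wolfe_powell_interval\<close>):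
  a minimum of \<open>\<phi> \<alpha> - \<sigma>\<^sub>1 \<alpha> \<phi>' 0\<close> gives a point at which both conditions hold strictly, so they
  persist nearby.
\<close>

section \<open>The Wolfe-Powell conditions in one variable\<close>

text \<open>
  The auxiliary function \<open>\<psi> \<alpha> = \<phi> \<alpha> - \<phi> 0 - \<sigma>\<^sub>1 \<alpha> \<phi>' 0\<close> starts at \<open>0\<close> with negative slope and, \<open>\<phi>\<close>
  being bounded below, is nonnegative far out. It therefore has a negative interior minimum, where
  \<open>\<phi>' = \<sigma>\<^sub>1 \<phi>' 0\<close> is strictly smaller in modulus than \<open>\<sigma>\<^sub>2 \<phi>' 0\<close>.
\<close>

lemma strong_wolfe_powell_interval:
  fixes \<phi> \<phi>' :: "real \<Rightarrow> real"
  assumes deriv: "\<And>x. 0 \<le> x \<Longrightarrow> (\<phi> has_real_derivative \<phi>' x) (at x within {0..})"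
    and cont: "continuous_on {0..} \<phi>'"
    and neg: "\<phi>' 0 < 0"
    and bdd: "bdd_below (\<phi> ` {0<..})"
    and sigma: "0 < \<sigma>\<^sub>1" "\<sigma>\<^sub>1 < \<sigma>\<^sub>2" "\<sigma>\<^sub>2 < 1"
  shows "\<exists>\<alpha>\<^sub>1 \<alpha>\<^sub>2. 0 < \<alpha>\<^sub>1 \<and> \<alpha>\<^sub>1 < \<alpha>\<^sub>2 \<and>
    (\<forall>\<alpha>\<in>{\<alpha>\<^sub>1<..<\<alpha>\<^sub>2}. \<phi> \<alpha> \<le> \<phi> 0 + \<sigma>\<^sub>1 * \<alpha> * \<phi>' 0 \<and> \<bar>\<phi>' \<alpha>\<bar> \<le> - \<sigma>\<^sub>2 * \<phi>' 0)"
proof -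
  define \<psi> where "\<psi> x = \<phi> x - \<phi> 0 - \<sigma>\<^sub>1 * x * \<phi>' 0" for x
  have psi_deriv: "(\<psi> has_real_derivative \<phi>' x - \<sigma>\<^sub>1 * \<phi>' 0) (at x within {0..})" if "0 \<le> x" for x
    unfolding \<psi>_def using deriv[OF that] by (auto intro!: derivative_eq_intros)
  have psi_cont: "continuous_on {0..} \<psi>"
    using psi_deriv by (intro DERIV_continuous_on) auto
  have slope: "\<phi>' 0 - \<sigma>\<^sub>1 * \<phi>' 0 < 0"
    using neg sigma mult_strict_right_mono_neg[of \<sigma>\<^sub>1 1 "\<phi>' 0"] by simp
  obtain \<delta> where "\<delta> > 0" and \<delta>: "\<And>h. 0 < h \<Longrightarrow> h < \<delta> \<Longrightarrow> \<psi> h < \<psi> 0"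
    using has_real_derivative_neg_dec_right[OF psi_deriv[of 0] slope] by auto
  define b where "b = \<delta> / 2"
  have b: "0 < b" "\<psi> b < 0"
    using \<open>\<delta> > 0\<close> \<delta>[of b] by (auto simp: b_def \<psi>_def)
  obtain m where m: "\<And>x. 0 < x \<Longrightarrow> m \<le> \<phi> x"
    using bdd by (auto simp: bdd_below_def)
  \<comment> \<open>\<open>\<psi> x \<ge> m - \<phi> 0 + x (- \<sigma>\<^sub>1 \<phi>' 0)\<close>, which is nonnegative as soon as \<open>x \<ge> (\<phi> 0 - m) / (- \<sigma>\<^sub>1 \<phi>' 0)\<close>.\<close>
  define A where "A = max b ((\<phi> 0 - m) / (- \<sigma>\<^sub>1 * \<phi>' 0))"
  have A: "b \<le> A" "0 < A" "\<psi> A \<ge> 0"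
  proof -
    show "b \<le> A" by (simp add: A_def)
    then show "0 < A" using b by simp
    have "0 < - \<sigma>\<^sub>1 * \<phi>' 0" using sigma neg by (simp add: mult_pos_neg)
    moreover have "(\<phi> 0 - m) / (- \<sigma>\<^sub>1 * \<phi>' 0) \<le> A" by (simp add: A_def)
    ultimately have "\<phi> 0 - m \<le> A * (- \<sigma>\<^sub>1 * \<phi>' 0)"
      by (simp only: pos_divide_le_eq)
    then show "\<psi> A \<ge> 0"
      using m[OF \<open>0 < A\<close>] by (simp add: \<psi>_def mult.commute mult.left_commute)
  qed
  have "\<exists>x\<in>{0..A}. \<forall>y\<in>{0..A}. \<psi> x \<le> \<psi> y"
    using A(2) by (intro continuous_attains_inf continuous_on_subset[OF psi_cont]) auto
  then obtain a where a: "0 \<le> a" "a \<le> A" and a_min: "\<And>y. 0 \<le> y \<Longrightarrow> y \<le> A \<Longrightarrow> \<psi> a \<le> \<psi> y"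
    by auto
  have psi_a: "\<psi> a < 0" using a_min[of b] b A by simp
  have "\<psi> 0 = 0" by (simp add: \<psi>_def)
  with psi_a A a have a_int: "0 < a" "a < A"
    by (metis less_le_not_le order_le_less)+
  have "at a within {0..} = at a"
    using a_int by (intro at_within_interior) (simp add: interior_real_atLeast)
  then have "(\<psi> has_real_derivative \<phi>' a - \<sigma>\<^sub>1 * \<phi>' 0) (at a)"
    using psi_deriv[of a] a by simp
  moreover have "\<forall>y. \<bar>a - y\<bar> < min a (A - a) \<longrightarrow> \<psi> a \<le> \<psi> y"
    by (intro allI impI a_min) auto
  ultimately have "\<phi>' a - \<sigma>\<^sub>1 * \<phi>' 0 = 0"
    using a_int by (intro DERIV_local_min[where d = "min a (A - a)"]) auto
  then have phi'_a: "\<bar>\<phi>' a\<bar> < - \<sigma>\<^sub>2 * \<phi>' 0"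
    using neg sigma mult_strict_right_mono_neg[of \<sigma>\<^sub>1 \<sigma>\<^sub>2 "\<phi>' 0"] by (simp add: abs_mult)
  have "isCont \<psi> a" "isCont \<phi>' a"
    using continuous_on_interior[OF psi_cont, of a] continuous_on_interior[OF cont, of a] a_int
    by (simp_all add: interior_real_atLeast)
  then have "(\<psi> \<longlongrightarrow> \<psi> a) (nhds a)" "((\<lambda>x. \<bar>\<phi>' x\<bar>) \<longlongrightarrow> \<bar>\<phi>' a\<bar>) (nhds a)"
    by (simp_all add: isCont_def tendsto_at_iff_tendsto_nhds tendsto_rabs)
  then have "\<forall>\<^sub>F x in nhds a. \<psi> x < 0" "\<forall>\<^sub>F x in nhds a. \<bar>\<phi>' x\<bar> < - \<sigma>\<^sub>2 * \<phi>' 0"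
    using psi_a phi'_a by (simp_all only: order_tendstoD(2))
  then have "\<forall>\<^sub>F x in nhds a. \<psi> x < 0 \<and> \<bar>\<phi>' x\<bar> < - \<sigma>\<^sub>2 * \<phi>' 0"
    by (rule eventually_conj)
  then obtain e where "e > 0"
    and e: "\<And>x. dist x a < e \<Longrightarrow> \<psi> x < 0 \<and> \<bar>\<phi>' x\<bar> < - \<sigma>\<^sub>2 * \<phi>' 0"
    by (auto simp: eventually_nhds_metric)
  show ?thesis
  proof (rule exI[of _ a], rule exI[of _ "a + e"], intro conjI ballI)
    fix x assume "x \<in> {a<..<a + e}"
    then have "dist x a < e" by (auto simp: dist_real_def)
    from e[OF this] show "\<phi> x \<le> \<phi> 0 + \<sigma>\<^sub>1 * x * \<phi>' 0" "\<bar>\<phi>' x\<bar> \<le> - \<sigma>\<^sub>2 * \<phi>' 0"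
      by (simp_all add: \<psi>_def)
  qed (use a_int \<open>e > 0\<close> in auto)
qed

section \<open>Composition with locally Lipschitz curves\<close>

lemma locally_lipschitz_on_imp_continuous_on:
  assumes "locally_lipschitz_on S f"
  shows "continuous_on S f"
proof (rule continuous_on_eq_continuous_within[THEN iffD2], rule ballI)
  fix x assume x: "x \<in> S"
  then obtain e C where "e > 0" and C: "C-lipschitz_on (S \<inter> ball x e) f"
    using assms by (auto simp: locally_lipschitz_on_def)
  have "continuous (at x within S \<inter> ball x e) f"
    using lipschitz_on_continuous_on[OF C] x \<open>e > 0\<close> by (simp add: continuous_on_eq_continuous_within)
  moreover have "at x within S \<inter> ball x e = at x within S"
    using \<open>e > 0\<close> by (intro at_within_nhd[where S = "ball x e"]) auto
  ultimately show "continuous (at x within S) f" by simp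
qed

lemma locally_lipschitz_on_compose_lipschitz:
  assumes g: "C-lipschitz_on S g" and f: "locally_lipschitz_on (g ` S) f"
  shows "locally_lipschitz_on S (f \<circ> g)"
  unfolding locally_lipschitz_on_def
proof
  fix x assume x: "x \<in> S"
  then obtain e D where "e > 0" and D: "D-lipschitz_on (g ` S \<inter> ball (g x) e) f"
    using f by (fastforce simp: locally_lipschitz_on_def)
  have "continuous (at x within S) g"
    using lipschitz_on_continuous_on[OF g] x by (simp add: continuous_on_eq_continuous_within)
  then obtain r where "r > 0" and r: "\<And>y. y \<in> S \<Longrightarrow> dist y x < r \<Longrightarrow> dist (g y) (g x) < e"
    using \<open>e > 0\<close> by (auto simp: continuous_within_eps_delta)
  have "(D * C)-lipschitz_on (S \<inter> ball x r) (f \<circ> g)"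
  proof (rule lipschitz_on_compose)
    show "C-lipschitz_on (S \<inter> ball x r) g"
      using g by (rule lipschitz_on_subset) auto
    show "D-lipschitz_on (g ` (S \<inter> ball x r)) f"
      using D by (rule lipschitz_on_subset) (use r in \<open>auto simp: dist_commute\<close>)
  qed
  then show "\<exists>e>0. \<exists>C. C-lipschitz_on (S \<inter> ball x e) (f \<circ> g)"
    using \<open>r > 0\<close> by blast
qed

text \<open>
  A chain rule for a curve \<open>\<gamma>\<close> that need not be differentiable: it is enough that the linear
  functional \<open>D\<close> sees a difference quotient \<open>c\<close> that converges. The remainder of \<open>f\<close> is
  \<open>o(\<parallel>\<gamma> y - \<gamma> x\<parallel>)\<close>, which the Lipschitz bound turns into \<open>o(\<bar>y - x\<bar>)\<close>.
\<close>

lemma has_real_derivative_along_lipschitz_curve: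
  fixes \<gamma> :: "real \<Rightarrow> 'a::real_normed_vector" and f :: "'a \<Rightarrow> real"
  assumes \<gamma>: "locally_lipschitz_on S \<gamma>" and x: "x \<in> S"
    and f: "(f has_derivative D) (at (\<gamma> x))"
    and D: "\<And>y. y \<in> S \<Longrightarrow> D (\<gamma> y - \<gamma> x) = (y - x) * c y"
    and c: "continuous (at x within S) c"
  shows "((\<lambda>y. f (\<gamma> y)) has_real_derivative c x) (at x within S)"
proof -
  obtain e C where "e > 0" and C: "C-lipschitz_on (S \<inter> ball x e) \<gamma>"
    using \<gamma> x by (auto simp: locally_lipschitz_on_def)
  have C0: "0 \<le> C" using C by (rule lipschitz_on_nonneg)
  have tendsto_\<gamma>: "(\<gamma> \<longlongrightarrow> \<gamma> x) (at x within S)"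
    using locally_lipschitz_on_imp_continuous_on[OF \<gamma>] x by (simp add: continuous_on)
  have near: "\<forall>\<^sub>F y in at x within S. y \<in> S \<inter> ball x e"
    using \<open>e > 0\<close> by (auto simp: eventually_at dist_commute)
  have remainder: "((\<lambda>y. (f (\<gamma> y) - f (\<gamma> x) - D (\<gamma> y - \<gamma> x)) / (y - x)) \<longlongrightarrow> 0) (at x within S)"
  proof (rule tendstoI)
    fix \<epsilon> :: real assume "\<epsilon> > 0"
    define \<eta> where "\<eta> = \<epsilon> / (C + 1)"
    have "\<eta> > 0" using \<open>\<epsilon> > 0\<close> C0 by (simp add: \<eta>_def)
    then obtain \<delta> where "\<delta> > 0" and \<delta>: "\<And>z. norm (z - \<gamma> x) < \<delta> \<Longrightarrow>
        norm (f z - f (\<gamma> x) - D (z - \<gamma> x)) \<le> \<eta> * norm (z - \<gamma> x)"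
      using f unfolding has_derivative_at_alt by blast
    have "\<forall>\<^sub>F y in at x within S. dist (\<gamma> y) (\<gamma> x) < \<delta>"
      using tendsto_\<gamma> \<open>\<delta> > 0\<close> by (rule tendstoD)
    moreover have "\<forall>\<^sub>F y in at x within S. y \<noteq> x"
      by (auto simp: eventually_at_filter)
    ultimately show "\<forall>\<^sub>F y in at x within S.
        dist ((f (\<gamma> y) - f (\<gamma> x) - D (\<gamma> y - \<gamma> x)) / (y - x)) 0 < \<epsilon>"
      using near
    proof eventually_elim
      case (elim y)
      have "norm (\<gamma> y - \<gamma> x) \<le> C * \<bar>y - x\<bar>"
        using lipschitz_onD[OF C, of y x] elim x \<open>e > 0\<close> by (simp add: dist_norm)
      then have "\<bar>f (\<gamma> y) - f (\<gamma> x) - D (\<gamma> y - \<gamma> x)\<bar> \<le> \<eta> * (C * \<bar>y - x\<bar>)"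
        using \<delta>[of "\<gamma> y"] elim \<open>\<eta> > 0\<close>
        by (smt (verit) dist_norm mult_left_mono real_norm_def)
      also have "\<dots> < \<epsilon> * \<bar>y - x\<bar>"
      proof -
        have "\<eta> * C < \<epsilon>"
          using \<open>\<epsilon> > 0\<close> C0 by (simp add: \<eta>_def field_simps)
        then show ?thesis
          using elim(2) by (simp flip: mult.assoc)
      qed
      finally show ?case
        using elim(2) by (simp add: field_simps)
    qed
  qed
  have "((\<lambda>y. c y + (f (\<gamma> y) - f (\<gamma> x) - D (\<gamma> y - \<gamma> x)) / (y - x)) \<longlongrightarrow> c x + 0) (at x within S)"
    using c remainder by (intro tendsto_add) (simp_all add: continuous_within)
  moreover have "\<forall>\<^sub>F y in at x within S. c y + (f (\<gamma> y) - f (\<gamma> x) - D (\<gamma> y - \<gamma> x)) / (y - x) =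
      (f (\<gamma> y) - f (\<gamma> x)) / (y - x)"
    using D by (auto simp: eventually_at_filter field_simps)
  ultimately have "((\<lambda>y. (f (\<gamma> y) - f (\<gamma> x)) / (y - x)) \<longlongrightarrow> c x) (at x within S)"
    by (simp add: tendsto_cong)
  then show ?thesis
    by (simp add: has_field_derivative_iff)
qed

section \<open>Derivatives at peaks\<close>

text \<open>
  Fermat's rule on the line \<open>s \<mapsto> x + s z\<close>. The set \<open>S\<close> need not be open, since half spaces have empty
  interior in general.
\<close>

lemma derivative_zero_at_local_max_along_segment:
  fixes f :: "'a::real_normed_vector \<Rightarrow> real"
  assumes max: "local_max_point_on f S x"
    and f: "(f has_derivative D) (at x)"
    and "r > 0" and seg: "\<And>s. \<bar>s\<bar> < r \<Longrightarrow> x + s *\<^sub>R z \<in> S"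
  shows "D z = 0"
proof -
  obtain e where "e > 0" and e: "\<And>y. y \<in> S \<Longrightarrow> dist x y < e \<Longrightarrow> f y \<le> f x"
    using max by (auto simp: local_max_point_on_def)
  define \<delta> where "\<delta> = min r (e / (norm z + 1))"
  have "\<delta> > 0" using \<open>r > 0\<close> \<open>e > 0\<close> by (simp add: \<delta>_def add_nonneg_pos)
  have inner: "((\<lambda>s. x + s *\<^sub>R z) has_derivative (\<lambda>s. s *\<^sub>R z)) (at 0)"
    by (auto intro!: derivative_eq_intros)
  have "((\<lambda>s. f (x + s *\<^sub>R z)) has_derivative (\<lambda>s. D (s *\<^sub>R z))) (at 0)"
    using has_derivative_compose[OF inner, of f D] f by simp
  moreover have "(\<lambda>s. D (s *\<^sub>R z)) = (*) (D z)"
    using has_derivative_bounded_linear[OF f]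
    by (auto simp: linear_cmul bounded_linear.linear mult.commute)
  ultimately have "((\<lambda>s. f (x + s *\<^sub>R z)) has_real_derivative D z) (at 0)"
    by (simp add: has_field_derivative_def)
  moreover have "\<forall>s. \<bar>0 - s\<bar> < \<delta> \<longrightarrow> f (x + s *\<^sub>R z) \<le> f (x + 0 *\<^sub>R z)"
  proof (intro allI impI)
    fix s :: real assume s: "\<bar>0 - s\<bar> < \<delta>"
    have "\<bar>s\<bar> * norm z \<le> \<bar>s\<bar> * (norm z + 1)" by (simp add: mult_left_mono)
    also have "\<dots> < e"
      using s by (simp add: \<delta>_def pos_less_divide_eq add_nonneg_pos)
    finally show "f (x + s *\<^sub>R z) \<le> f (x + 0 *\<^sub>R z)"
      using e[of "x + s *\<^sub>R z"] seg[of s] s by (simp add: \<delta>_def dist_norm)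
  qed
  ultimately show ?thesis
    using \<open>\<delta> > 0\<close> by (blast intro: DERIV_local_max[where d = \<delta>])
qed

text \<open>
  A positive coefficient \<open>t\<close> leaves room to move backwards along the ray; at \<open>t = 0\<close> only the one-sided
  inequality \<open>D u \<le> 0\<close> would remain.
\<close>

lemma derivative_zero_at_half_space_max:
  fixes f :: "'a::real_normed_vector \<Rightarrow> real"
  assumes max: "local_max_point_on f (half_space L u) (t *\<^sub>R u + w)"
    and f: "(f has_derivative D) (at (t *\<^sub>R u + w))"
    and L: "subspace L" and t: "0 < t" and w: "w \<in> L"
  shows "D u = 0" and "z \<in> L \<Longrightarrow> D z = 0"
proof -
  show "D u = 0"
  proof (rule derivative_zero_at_local_max_along_segment[OF max f t])
    fix s :: real assume "\<bar>s\<bar> < t"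
    moreover have "t *\<^sub>R u + w + s *\<^sub>R u = (t + s) *\<^sub>R u + w"
      by (simp add: algebra_simps)
    moreover have "0 \<le> t + s" using \<open>\<bar>s\<bar> < t\<close> by simp
    ultimately show "t *\<^sub>R u + w + s *\<^sub>R u \<in> half_space L u"
      using w unfolding half_space_def by blast
  qed
  show "D z = 0" if "z \<in> L"
  proof (rule derivative_zero_at_local_max_along_segment[OF max f zero_less_one])
    fix s :: real
    have "w + s *\<^sub>R z \<in> L"
      using L w that by (simp add: subspace_add subspace_scale)
    moreover have "t *\<^sub>R u + w + s *\<^sub>R z = t *\<^sub>R u + (w + s *\<^sub>R z)"
      by simp
    ultimately show "t *\<^sub>R u + w + s *\<^sub>R z \<in> half_space L u"
      using t unfolding half_space_def by (metis (mono_tags, lifting) less_imp_le mem_Collect_eq)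
  qed
qed

section \<open>Geometry of the search curve\<close>

text \<open>
  The orthogonal projection onto a finite-dimensional subspace of an inner product space of any
  dimension: subtract the components along a finite orthogonal spanning set.
\<close>

lemma orthogonal_residual_of_finite_span:
  fixes x :: "'a::real_inner"
  assumes "finite B"
  obtains y where "y \<in> span B" and "\<And>z. z \<in> span B \<Longrightarrow> orthogonal z (x - y)"
proof -
  obtain C where C: "finite C" "span C = span B" "pairwise orthogonal C"
    using basis_orthogonal[OF assms] by blast
  define y where "y = (\<Sum>b\<in>C. (b \<bullet> x / (b \<bullet> b)) *\<^sub>R b)"
  have "orthogonal (x - y) b" if b: "b \<in> C" for b
  proof -
    have "y \<bullet> b = (\<Sum>a\<in>C. if a = b then b \<bullet> x else 0)"
      unfolding y_def inner_sum_left
      using C(3) b by (intro sum.cong) (auto simp: pairwise_def orthogonal_def)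
    also have "\<dots> = b \<bullet> x" using C(1) b by simp
    finally show ?thesis
      by (simp add: orthogonal_def inner_diff_left inner_commute[of x b])
  qed
  then have "orthogonal z (x - y)" if "z \<in> span B" for z
    using that C(2) orthogonal_to_span[of z C "x - y"] by (simp add: orthogonal_commute)
  moreover have "y \<in> span B"
    unfolding y_def C(2)[symmetric] by (intro span_sum span_scale span_base)
  ultimately show ?thesis by (rule that[rotated])
qed

text \<open>
  Since \<open>v \<bottom> d\<close>, the line \<open>v + \<alpha> d\<close> stays outside the open unit ball, where normalization is
  Lipschitz; this transfers the regularity of \<open>p\<close> to a function of \<open>\<alpha>\<close>.
\<close>

lemma dist_normalized_le:
  fixes x y :: "'a::real_normed_vector"
  assumes x: "1 \<le> norm x" and y: "1 \<le> norm y"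
  shows "dist (x /\<^sub>R norm x) (y /\<^sub>R norm y) \<le> 2 * dist x y"
proof -
  have "x /\<^sub>R norm x - y /\<^sub>R norm y =
      (x - y) /\<^sub>R norm x + (inverse (norm x) - inverse (norm y)) *\<^sub>R y"
    by (simp add: algebra_simps)
  also have "norm \<dots> \<le> norm (x - y) / norm x + \<bar>inverse (norm x) - inverse (norm y)\<bar> * norm y"
    by (rule norm_triangle_le) (simp add: divide_inverse)
  also have "\<bar>inverse (norm x) - inverse (norm y)\<bar> * norm y = \<bar>norm y - norm x\<bar> / norm x"
  proof -
    have nz: "norm x \<noteq> 0" "norm y \<noteq> 0" using x y by auto
    then have "inverse (norm x) - inverse (norm y) = (norm y - norm x) / (norm x * norm y)"
      by (simp add: field_simps)
    then show ?thesis using nz by (simp add: abs_mult abs_divide)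
  qed
  also have "\<bar>norm y - norm x\<bar> / norm x \<le> norm (x - y) / norm x"
    using norm_triangle_ineq3[of y x] by (intro divide_right_mono) (simp_all add: norm_minus_commute)
  also have "norm (x - y) / norm x + norm (x - y) / norm x \<le> 2 * norm (x - y)"
  proof -
    have "norm (x - y) / norm x \<le> norm (x - y) / 1"
      using x by (intro divide_left_mono) auto
    then show ?thesis by simp
  qed
  finally show ?thesis by (simp add: dist_norm)
qed

lemma norm_add_orthogonal_scaleR:
  fixes v d :: "'a::real_inner"
  assumes "norm v = 1" and "v \<bullet> d = 0"
  shows "norm (v + \<alpha> *\<^sub>R d) = sqrt (1 + \<alpha>\<^sup>2 * (norm d)\<^sup>2)"
proof -
  have "v \<bullet> v = 1" using assms(1) by (simp add: dot_square_norm)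
  then show ?thesis
    unfolding norm_eq_sqrt_inner[of "v + \<alpha> *\<^sub>R d"] power2_norm_eq_inner using assms(2)
    by (simp add: inner_add_left inner_add_right inner_commute[of d v] power2_eq_square)
qed

lemma search_curve_lipschitz:
  fixes v d :: "'a::real_inner"
  assumes "norm v = 1" and "v \<bullet> d = 0"
  shows "(2 * norm d)-lipschitz_on S (search_curve v d)"
proof (rule lipschitz_onI)
  fix \<alpha> \<beta>
  have ge1: "1 \<le> norm (v + s *\<^sub>R d)" for s
    by (simp add: norm_add_orthogonal_scaleR[OF assms])
  have "(v + \<alpha> *\<^sub>R d) - (v + \<beta> *\<^sub>R d) = (\<alpha> - \<beta>) *\<^sub>R d"
    by (simp add: algebra_simps)
  then have "dist (v + \<alpha> *\<^sub>R d) (v + \<beta> *\<^sub>R d) = dist \<alpha> \<beta> * norm d"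
    by (simp only: dist_norm norm_scaleR real_norm_def)
  then show "dist (search_curve v d \<alpha>) (search_curve v d \<beta>) \<le> 2 * norm d * dist \<alpha> \<beta>"
    using dist_normalized_le[OF ge1[of \<alpha>] ge1[of \<beta>]] by (simp only: search_curve_def mult_ac)
qed simp

section \<open>The step-size rule\<close>

theorem theorem3p7:
  fixes E :: "'a::{real_inner, complete_space} \<Rightarrow> real"
    and E' :: "'a \<Rightarrow> ('a \<Rightarrow>\<^sub>L real)"
    and L :: "'a set"
    and p w :: "'a \<Rightarrow> 'a"
    and t :: "'a \<Rightarrow> real"
    and v d :: 'a
    and \<sigma>\<^sub>1 \<sigma>\<^sub>2 :: real
  assumes E_deriv: "\<And>u. (E has_derivative blinfun_apply (E' u)) (at u)"
    and E'_cont: "continuous_on UNIV E'"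
    and zero_min: "local_minimizer E 0"
    and L_subspace: "subspace L"
    and L_findim: "\<exists>B. finite B \<and> span B = L"
    and v_sphere: "v \<in> sphere 0 1 - L"
    and d_orth: "d \<in> (half_space L v)\<^sup>\<bottom>"
    and p_peak: "peak_selection E L p"
    and p_decomp: "\<And>u. u \<in> sphere 0 1 \<Longrightarrow> p u = t u *\<^sub>R u + w u \<and> 0 \<le> t u \<and> w u \<in> L"
    and t_curve_pos: "\<And>\<alpha>. 0 \<le> \<alpha> \<Longrightarrow> 0 < t (search_curve v d \<alpha>)"
    and p_lipschitz: "locally_lipschitz_on {search_curve v d \<alpha> | \<alpha>. 0 \<le> \<alpha>} p"
    and t_v_pos: "0 < t v"
    and descent: "blinfun_apply (E' (p v)) d < 0"
    and bounded_below: "bdd_below {E (p (search_curve v d \<alpha>)) | \<alpha>. 0 < \<alpha>}"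
    and sigma: "0 < \<sigma>\<^sub>1" "\<sigma>\<^sub>1 < \<sigma>\<^sub>2" "\<sigma>\<^sub>2 < 1"
  shows "\<exists>\<alpha>\<^sub>1 \<alpha>\<^sub>2. 0 < \<alpha>\<^sub>1 \<and> \<alpha>\<^sub>1 < \<alpha>\<^sub>2 \<and>
    (\<forall>\<alpha>\<in>{\<alpha>\<^sub>1<..<\<alpha>\<^sub>2}.
       (E (p (search_curve v d \<alpha>)) \<le> E (p v) + \<sigma>\<^sub>1 * \<alpha> * t v * blinfun_apply (E' (p v)) d \<and>
        normalized_coeff t v d \<alpha> * \<bar>blinfun_apply (E' (p (search_curve v d \<alpha>))) d\<bar>
          \<le> - \<sigma>\<^sub>2 * t v * blinfun_apply (E' (p v)) d) \<and>
       (E (p (search_curve v d \<alpha>)) \<le> E (p v) + \<sigma>\<^sub>1 * \<alpha> * t v * blinfun_apply (E' (p v)) d \<and>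
        normalized_coeff t v d \<alpha> * blinfun_apply (E' (p (search_curve v d \<alpha>))) d
          \<ge> \<sigma>\<^sub>2 * t v * blinfun_apply (E' (p v)) d))"
proof -
  define \<gamma> where "\<gamma> \<alpha> = p (search_curve v d \<alpha>)" for \<alpha>
  define c where "c = normalized_coeff t v d"
  define ww where "ww \<alpha> = w (search_curve v d \<alpha>)" for \<alpha>
  have v_norm: "norm v = 1" and v_L: "v \<notin> L" using v_sphere by auto
  have curve_0: "search_curve v d 0 = v" by (simp add: search_curve_def v_norm)
  have "v \<in> half_space L v" "L \<subseteq> half_space L v"
    using subspace_0[OF L_subspace] unfolding half_space_def
    by (force intro: exI[of _ 1], force intro: exI[of _ 0])
  then have vd: "v \<bullet> d = 0" and Ld: "\<And>z. z \<in> L \<Longrightarrow> z \<bullet> d = 0"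
    using d_orth by (auto simp: orthogonal_comp_def orthogonal_def)
  note norm_curve = norm_add_orthogonal_scaleR[OF v_norm vd]
  have norm_pos: "0 < norm (v + \<alpha> *\<^sub>R d)" for \<alpha>
    unfolding norm_curve by (simp add: add_pos_nonneg)
  have curve_sphere: "search_curve v d \<alpha> \<in> sphere 0 1" for \<alpha>
    using norm_pos[of \<alpha>] by (simp add: search_curve_def)
  have \<gamma>_decomp: "\<gamma> \<alpha> = c \<alpha> *\<^sub>R (v + \<alpha> *\<^sub>R d) + ww \<alpha>" and ww_L: "ww \<alpha> \<in> L" for \<alpha>
    using p_decomp[OF curve_sphere[of \<alpha>]]
    by (simp_all add: \<gamma>_def ww_def c_def normalized_coeff_def norm_curve search_curve_def
        divide_inverse)

  have curve_image: "search_curve v d ` {0..} = {search_curve v d \<alpha> | \<alpha>. 0 \<le> \<alpha>}"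
    by auto
  have "locally_lipschitz_on {0..} (p \<circ> search_curve v d)"
    by (rule locally_lipschitz_on_compose_lipschitz[OF search_curve_lipschitz[OF v_norm vd]])
      (simp add: curve_image p_lipschitz)
  then have \<gamma>_lip: "locally_lipschitz_on {0..} \<gamma>"
    by (simp add: \<gamma>_def[abs_def] comp_def)
  then have \<gamma>_cont: "continuous_on {0..} \<gamma>"
    by (rule locally_lipschitz_on_imp_continuous_on)

  \<comment> \<open>Pairing \<open>\<gamma>\<close> with the component of \<open>v\<close> orthogonal to \<open>L\<close> isolates the coefficient \<open>c\<close>.\<close>
  obtain y where y: "y \<in> L" and y_orth: "\<And>z. z \<in> L \<Longrightarrow> orthogonal z (v - y)"
    using L_findim orthogonal_residual_of_finite_span[of _ v] by metis
  define q where "q = v - y"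
  have "q \<noteq> 0" using y v_L by (auto simp: q_def)
  have Lq: "z \<bullet> q = 0" if "z \<in> L" for z
    using y_orth[OF that] by (simp add: orthogonal_def q_def)
  have dq: "d \<bullet> q = 0"
    using vd Ld[OF y] by (simp add: q_def inner_diff_right inner_commute)
  have "v \<bullet> q = q \<bullet> q"
    using Lq[OF y] by (simp add: q_def inner_diff_left)
  then have c_eq: "c \<alpha> = (\<gamma> \<alpha> \<bullet> q) / (q \<bullet> q)" for \<alpha>
    using \<open>q \<noteq> 0\<close> Lq[OF ww_L[of \<alpha>]] dq by (simp add: \<gamma>_decomp inner_add_left)
  have c_cont: "continuous_on {0..} c"
    unfolding c_eq[abs_def] using \<open>q \<noteq> 0\<close> \<gamma>_cont by (intro continuous_intros) auto

  have E'_zero: "E' (\<gamma> \<alpha>) (v + \<alpha> *\<^sub>R d) = 0" "\<And>z. z \<in> L \<Longrightarrow> E' (\<gamma> \<alpha>) z = 0" if "0 \<le> \<alpha>" for \<alpha>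
  proof -
    define u where "u = search_curve v d \<alpha>"
    have u: "\<gamma> \<alpha> = t u *\<^sub>R u + w u" "w u \<in> L" "0 < t u"
      using p_decomp[OF curve_sphere[of \<alpha>]] t_curve_pos[OF that] by (simp_all add: \<gamma>_def u_def)
    have max: "local_max_point_on E (half_space L u) (t u *\<^sub>R u + w u)"
    proof -
      have "p u \<in> peak_mapping E L u"
        using p_peak curve_sphere[of \<alpha>] unfolding peak_selection_def u_def by blast
      then show ?thesis
        using u(1) by (simp add: peak_mapping_def u_def \<gamma>_def)
    qed
    note zero = derivative_zero_at_half_space_max[OF max E_deriv L_subspace u(3,2)]
    show "E' (\<gamma> \<alpha>) z = 0" if "z \<in> L" for z
      using zero(2)[OF that] u(1) by simp
    have "v + \<alpha> *\<^sub>R d = norm (v + \<alpha> *\<^sub>R d) *\<^sub>R u"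
      using norm_pos[of \<alpha>] by (simp add: u_def search_curve_def)
    then show "E' (\<gamma> \<alpha>) (v + \<alpha> *\<^sub>R d) = 0"
      using zero(1) u(1) by (metis blinfun.scaleR_right scaleR_zero_right)
  qed

  have deriv: "((\<lambda>\<alpha>. E (\<gamma> \<alpha>)) has_real_derivative c \<alpha> * E' (\<gamma> \<alpha>) d) (at \<alpha> within {0..})"
    if \<alpha>: "0 \<le> \<alpha>" for \<alpha>
  proof (rule has_real_derivative_along_lipschitz_curve
        [OF \<gamma>_lip _ E_deriv, where c = "\<lambda>\<beta>. c \<beta> * E' (\<gamma> \<alpha>) d"])
    show "\<alpha> \<in> {0..}" using \<alpha> by simp
    show "continuous (at \<alpha> within {0..}) (\<lambda>\<beta>. c \<beta> * E' (\<gamma> \<alpha>) d)"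
      using c_cont \<alpha> by (intro continuous_intros) (simp add: continuous_on_eq_continuous_within)
    fix \<beta> :: real
    \<comment> \<open>Expanding around \<open>v + \<alpha> d\<close> puts all but the \<open>d\<close> term into the kernel of \<open>E' (\<gamma> \<alpha>)\<close>.\<close>
    have "\<gamma> \<beta> - \<gamma> \<alpha> =
        (c \<beta> - c \<alpha>) *\<^sub>R (v + \<alpha> *\<^sub>R d) + ((\<beta> - \<alpha>) * c \<beta>) *\<^sub>R d + (ww \<beta> - ww \<alpha>)"
      by (simp add: \<gamma>_decomp algebra_simps)
    moreover have "E' (\<gamma> \<alpha>) (ww \<beta> - ww \<alpha>) = 0"
      by (intro E'_zero \<alpha> subspace_diff L_subspace ww_L)
    ultimately show "E' (\<gamma> \<alpha>) (\<gamma> \<beta> - \<gamma> \<alpha>) = (\<beta> - \<alpha>) * (c \<beta> * E' (\<gamma> \<alpha>) d)"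
      using E'_zero(1)[OF \<alpha>] by (simp only: blinfun.add_right blinfun.scaleR_right) simp
  qed

  have "continuous_on {0..} (\<lambda>\<alpha>. E' (\<gamma> \<alpha>))"
    by (rule continuous_on_compose2[OF E'_cont \<gamma>_cont]) simp
  then have deriv_cont: "continuous_on {0..} (\<lambda>\<alpha>. c \<alpha> * E' (\<gamma> \<alpha>) d)"
    using c_cont by (intro continuous_intros)
  have start: "\<gamma> 0 = p v" "c 0 = t v"
    by (simp_all add: \<gamma>_def c_def normalized_coeff_def curve_0)
  have bdd: "bdd_below ((\<lambda>\<alpha>. E (\<gamma> \<alpha>)) ` {0<..})"
    using bounded_below by (rule bdd_below_mono) (auto simp: \<gamma>_def)
  have neg: "c 0 * E' (\<gamma> 0) d < 0"
    using t_v_pos descent by (simp add: start mult_pos_neg)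
  obtain \<alpha>\<^sub>1 \<alpha>\<^sub>2 where pos: "0 < \<alpha>\<^sub>1" and less: "\<alpha>\<^sub>1 < \<alpha>\<^sub>2"
    and wolfe: "\<And>\<alpha>. \<alpha> \<in> {\<alpha>\<^sub>1<..<\<alpha>\<^sub>2} \<Longrightarrow> E (\<gamma> \<alpha>) \<le> E (\<gamma> 0) + \<sigma>\<^sub>1 * \<alpha> * (c 0 * E' (\<gamma> 0) d) \<and>
      \<bar>c \<alpha> * E' (\<gamma> \<alpha>) d\<bar> \<le> - \<sigma>\<^sub>2 * (c 0 * E' (\<gamma> 0) d)"
    using strong_wolfe_powell_interval[OF deriv deriv_cont neg bdd sigma] by blast
  have c_nonneg: "0 \<le> c \<alpha>" if "0 \<le> \<alpha>" for \<alpha>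
    using t_curve_pos[OF that] by (simp add: c_def normalized_coeff_def)
  show ?thesis
  proof (rule exI[of _ \<alpha>\<^sub>1], rule exI[of _ \<alpha>\<^sub>2], intro conjI ballI)
    fix \<alpha> assume \<alpha>: "\<alpha> \<in> {\<alpha>\<^sub>1<..<\<alpha>\<^sub>2}"
    have "0 \<le> \<alpha>" using \<alpha> pos by simp
    note c_nonneg[OF this]
    then have abs_eq: "\<bar>c \<alpha> * E' (\<gamma> \<alpha>) d\<bar> = c \<alpha> * \<bar>E' (\<gamma> \<alpha>) d\<bar>" by (simp add: abs_mult)
    show "E (p (search_curve v d \<alpha>)) \<le> E (p v) + \<sigma>\<^sub>1 * \<alpha> * t v * E' (p v) d"
      using wolfe[OF \<alpha>] unfolding start unfolding \<gamma>_def by (simp add: mult.assoc)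
    then show "E (p (search_curve v d \<alpha>)) \<le> E (p v) + \<sigma>\<^sub>1 * \<alpha> * t v * E' (p v) d" .
    show "normalized_coeff t v d \<alpha> * \<bar>E' (p (search_curve v d \<alpha>)) d\<bar> \<le> - \<sigma>\<^sub>2 * t v * E' (p v) d"
      using wolfe[OF \<alpha>] unfolding abs_eq start unfolding \<gamma>_def c_def by (simp add: mult.assoc)
    show "normalized_coeff t v d \<alpha> * E' (p (search_curve v d \<alpha>)) d \<ge> \<sigma>\<^sub>2 * t v * E' (p v) d"
      using wolfe[OF \<alpha>] unfolding start unfolding \<gamma>_def c_def by (simp add: mult.assoc abs_le_iff)
  qed (use pos less in auto)
qed

end
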